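(* Let $S\equiv(S,I,\mathbf d,\mathbf r,\cdot)$ be a partial semigroup, let $i,j\in I$, and suppose $a\in S_{ji}$ has a left- and right-identity in $S$, i.e. $a=ea=af$ for some $e,f\in S$. Let $x,y\in S_{ij}$. (i) If $x\in P_1^a$, then $x\leq_{\mathscr J^a}y\Leftrightarrow x\leq_{\mathscr J}aya$ or $x\leq_{\mathscr R}ya$. (ii) If $x\in P_2^a$, then $x\leq_{\mathscr J^a}y\Leftrightarrow x\leq_{\mathscr J}aya$ or $x\leq_{\mathscr L}ay$. (iii) If $x\in P_3^a$, then $x\leq_{\mathscr J^a}y\Leftrightarrow x\leq_{\mathscr J}aya$. (iv) If $y\in P_1^a$, then $x\leq_{\mathscr J^a}y\Leftrightarrow x\leq_{\mathscr J}ay$ or $x\leq_{\mathscr R}y$. (v) If $y\in P_2^a$, then $x\leq_{\mathscr J^a}y\Leftrightarrow x\leq_{\mathscr J}ya$ or $x\leq_{\mathscr L}y$. (vi) If $y\in P_3^a$, then $x\leq_{\mathscr J^a}y\Leftrightarrow x\leq_{\mathscr J}y$.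
   Context: A partial semigroup $(S,I,\mathbf d,\mathbf r,\cdot)$ consists of sets $S,I$, maps $\mathbf d,\mathbf r:S\to I$ and a partial binary operation on $S$ such that: $x\cdot y$ is defined iff $\mathbf r(x)=\mathbf d(y)$, in which case $\mathbf d(xy)=\mathbf d(x)$ and $\mathbf r(xy)=\mathbf r(y)$; and $(xy)z=x(yz)$ whenever $xy$ and $yz$ are defined. $S_{ij}=\{x\in S:\mathbf d(x)=i,\ \mathbf r(x)=j\}$. $S^{(1)}$ denotes the category obtained from $S$ by adjoining an identity at each object of $I$ that does not already have one. Green's preorders on $S$: $x\leq_{\mathscr R}y$ iff $x=yu$ for some $u\in S^{(1)}$; $x\leq_{\mathscr L}y$ iff $x=uy$ for some $u\in S^{(1)}$; $x\leq_{\mathscr J}y$ iff $x=uyv$ for some $u,v\in S^{(1)}$. Green's relations: $\mathscr K={\leq_{\mathscr K}}\cap{\geq_{\mathscr K}}$ for $\mathscr K\in\{\mathscr R,\mathscr L,\mathscr J\}$. For $a\in S_{ji}$, the sandwich semigroup $S_{ij}^a$ is the set $S_{ij}$ with the associative operation $x\star_ay=xay$; $\leq_{\mathscr J^a}$ is the $\leq_{\mathscr J}$ preorder of the semigroup $S_{ij}^a$ (so $x\leq_{\mathscr J^a}y$ iff $x$ belongs to the principal two-sided ideal of $S_{ij}^a$ generated by $y$). Further, $P_1^a=\{x\in S_{ij}:xa\,\mathscr R\,x\}$, $P_2^a=\{x\in S_{ij}:ax\,\mathscr L\,x\}$, $P_3^a=\{x\in S_{ij}:axa\,\mathscr J\,x\}$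 (relations taken in $S$). *)

theory Defs
  imports Main
begin

record ('a, 'i) psg =
  arr :: "'a set"
  obj :: "'i set"
  src :: "'a \<Rightarrow> 'i"
  tgt :: "'a \<Rightarrow> 'i"
  mult :: "'a \<Rightarrow> 'a \<Rightarrow> 'a"  (infixl \<open>\<cdot>\<index>\<close> 70)

text \<open>The maps \<open>d\<close> and \<open>r\<close> are \<open>src\<close> and \<open>tgt\<close>. The partial operation is rendered by a total
  function whose values matter only on the pairs satisfying the following predicate, which is the
  domain of the operation; every product occurring below is of such a pair.\<close>

definition composable :: "('a, 'i, 'm) psg_scheme \<Rightarrow> 'a \<Rightarrow> 'a \<Rightarrow> bool" where
  "composable S x y \<longleftrightarrow> x \<in> arr S \<and> y \<in> arr S \<and> tgt S x = src S y"

locale partial_semigroup =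
  fixes S :: "('a, 'i, 'm) psg_scheme" (structure)
  assumes src_in: "x \<in> arr S \<Longrightarrow> src S x \<in> obj S"
    and tgt_in: "x \<in> arr S \<Longrightarrow> tgt S x \<in> obj S"
    and mult_in: "composable S x y \<Longrightarrow> x \<cdot> y \<in> arr S"
    and src_mult: "composable S x y \<Longrightarrow> src S (x \<cdot> y) = src S x"
    and tgt_mult: "composable S x y \<Longrightarrow> tgt S (x \<cdot> y) = tgt S y"
    and assoc: "composable S x y \<Longrightarrow> composable S y z \<Longrightarrow> (x \<cdot> y) \<cdot> z = x \<cdot> (y \<cdot> z)"

definition hom :: "('a, 'i, 'm) psg_scheme \<Rightarrow> 'i \<Rightarrow> 'i \<Rightarrow> 'a set" where
  "hom S i j = {x \<in> arr S. src S x = i \<and> tgt S x = j}"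

definition is_identity :: "('a, 'i, 'm) psg_scheme \<Rightarrow> 'i \<Rightarrow> 'a \<Rightarrow> bool" where
  "is_identity S i e \<longleftrightarrow> e \<in> hom S i i \<and>
     (\<forall>x \<in> arr S. src S x = i \<longrightarrow> e \<cdot>\<^bsub>S\<^esub> x = x) \<and>
     (\<forall>x \<in> arr S. tgt S x = i \<longrightarrow> x \<cdot>\<^bsub>S\<^esub> e = x)"

text \<open>In \<open>S\<^sup>(\<^sup>1\<^sup>)\<close>, \<open>Inl x\<close> is the copy of \<open>x\<close> in \<open>S\<close>, and \<open>Inr i\<close> is the identity adjoined at
  the object \<open>i\<close>.\<close>

fun mult1 :: "('a, 'i, 'm) psg_scheme \<Rightarrow> 'a + 'i \<Rightarrow> 'a + 'i \<Rightarrow> 'a + 'i" where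
  "mult1 S (Inl x) (Inl y) = Inl (x \<cdot>\<^bsub>S\<^esub> y)"
| "mult1 S (Inl x) (Inr i) = Inl x"
| "mult1 S (Inr i) y = y"

definition adjoin_ids :: "('a, 'i, 'm) psg_scheme \<Rightarrow> ('a + 'i, 'i) psg" where
  "adjoin_ids S =
     \<lparr> arr = Inl ` arr S \<union> Inr ` {i \<in> obj S. \<nexists>e. is_identity S i e},
       obj = obj S,
       src = case_sum (src S) (\<lambda>i. i),
       tgt = case_sum (tgt S) (\<lambda>i. i),
       mult = mult1 S \<rparr>"

definition leR :: "('a, 'i, 'm) psg_scheme \<Rightarrow> 'a \<Rightarrow> 'a \<Rightarrow> bool" where
  "leR S x y \<longleftrightarrow> x \<in> arr S \<and> y \<in> arr S \<and>
     (\<exists>u. composable (adjoin_ids S) (Inl y) u \<and> Inl x = Inl y \<cdot>\<^bsub>adjoin_ids S\<^esub> u)"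

definition leL :: "('a, 'i, 'm) psg_scheme \<Rightarrow> 'a \<Rightarrow> 'a \<Rightarrow> bool" where
  "leL S x y \<longleftrightarrow> x \<in> arr S \<and> y \<in> arr S \<and>
     (\<exists>u. composable (adjoin_ids S) u (Inl y) \<and> Inl x = u \<cdot>\<^bsub>adjoin_ids S\<^esub> Inl y)"

definition leJ :: "('a, 'i, 'm) psg_scheme \<Rightarrow> 'a \<Rightarrow> 'a \<Rightarrow> bool" where
  "leJ S x y \<longleftrightarrow> x \<in> arr S \<and> y \<in> arr S \<and>
     (\<exists>u v. composable (adjoin_ids S) u (Inl y) \<and> composable (adjoin_ids S) (Inl y) v \<and>
            Inl x = u \<cdot>\<^bsub>adjoin_ids S\<^esub> Inl y \<cdot>\<^bsub>adjoin_ids S\<^esub> v)"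

definition relR :: "('a, 'i, 'm) psg_scheme \<Rightarrow> 'a \<Rightarrow> 'a \<Rightarrow> bool" where
  "relR S x y \<longleftrightarrow> leR S x y \<and> leR S y x"

definition relL :: "('a, 'i, 'm) psg_scheme \<Rightarrow> 'a \<Rightarrow> 'a \<Rightarrow> bool" where
  "relL S x y \<longleftrightarrow> leL S x y \<and> leL S y x"

definition relJ :: "('a, 'i, 'm) psg_scheme \<Rightarrow> 'a \<Rightarrow> 'a \<Rightarrow> bool" where
  "relJ S x y \<longleftrightarrow> leJ S x y \<and> leJ S y x"

text \<open>A semigroup is a partial semigroup with a single object. Viewing the sandwich semigroup this
  way makes \<open>leJ\<close> of it the usual \<open>J\<close>-preorder of a semigroup.\<close>

definition sandwich :: "('a, 'i, 'm) psg_scheme \<Rightarrow> 'i \<Rightarrow> 'i \<Rightarrow> 'a \<Rightarrow> ('a, unit) psg" where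
  "sandwich S i j a =
     \<lparr> arr = hom S i j,
       obj = {()},
       src = (\<lambda>_. ()),
       tgt = (\<lambda>_. ()),
       mult = (\<lambda>x y. x \<cdot>\<^bsub>S\<^esub> a \<cdot>\<^bsub>S\<^esub> y) \<rparr>"

definition P1 :: "('a, 'i, 'm) psg_scheme \<Rightarrow> 'i \<Rightarrow> 'i \<Rightarrow> 'a \<Rightarrow> 'a set" where
  "P1 S i j a = {x \<in> hom S i j. relR S (x \<cdot>\<^bsub>S\<^esub> a) x}"

definition P2 :: "('a, 'i, 'm) psg_scheme \<Rightarrow> 'i \<Rightarrow> 'i \<Rightarrow> 'a \<Rightarrow> 'a set" where
  "P2 S i j a = {x \<in> hom S i j. relL S (a \<cdot>\<^bsub>S\<^esub> x) x}"

definition P3 :: "('a, 'i, 'm) psg_scheme \<Rightarrow> 'i \<Rightarrow> 'i \<Rightarrow> 'a \<Rightarrow> 'a set" where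
  "P3 S i j a = {x \<in> hom S i j. relJ S (a \<cdot>\<^bsub>S\<^esub> x \<cdot>\<^bsub>S\<^esub> a) x}"

end

theory Submission
  imports Defs
begin

text \<open>
  Because \<open>a = e \<cdot> a = a \<cdot> f\<close>, a factor of \<open>S\<^sup>(\<^sup>1\<^sup>)\<close> next to \<open>a\<close> can be replaced
  by a genuine element of \<open>S\<close>: in \<open>u \<cdot> a\<close> the factor \<open>u\<close> may be exchanged for \<open>u \<cdot> e\<close>, and
  in \<open>a \<cdot> v\<close> the factor \<open>v\<close> for \<open>f \<cdot> v\<close>; an adjoined identity thereby turns into \<open>e\<close> or \<open>f\<close>.
  For \<open>x\<close> and \<open>y\<close> in \<open>S\<^sub>i\<^sub>j\<close> this gives
  \<^item> \<open>x \<le> y \<cdot> a\<close> in the \<open>R\<close>-preorder iff \<open>x = y \<cdot> a \<cdot> v\<close> with \<open>v\<close> in \<open>S\<^sub>i\<^sub>j\<close> (\<open>leR_mult_a_iff\<close>);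
  \<^item> \<open>x \<le> a \<cdot> y\<close> in the \<open>L\<close>-preorder iff \<open>x = u \<cdot> a \<cdot> y\<close> with \<open>u\<close> in \<open>S\<^sub>i\<^sub>j\<close> (\<open>leL_a_mult_iff\<close>);
  \<^item> \<open>x \<le> a \<cdot> y \<cdot> a\<close> in the \<open>J\<close>-preorder iff \<open>x = u \<cdot> a \<cdot> y \<cdot> a \<cdot> v\<close> with \<open>u\<close> and \<open>v\<close> in
    \<open>S\<^sub>i\<^sub>j\<close> (\<open>leJ_a_mult_a_iff\<close>).

  These are three of the four ways in which \<open>x\<close> can lie below \<open>y\<close> in the sandwich semigroup, the
  fourth being \<open>x = y\<close> (\<open>leJ_sandwich_iff\<close>). They also show that membership of \<open>x\<close> in \<open>P1\<close>, \<open>P2\<close>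
  or \<open>P3\<close> yields a factorisation \<open>x = x \<cdot> a \<cdot> w\<close>, \<open>x = w \<cdot> a \<cdot> x\<close> or \<open>x = p \<cdot> a \<cdot> x \<cdot> a \<cdot> q\<close> with
  \<open>w\<close>, \<open>p\<close>, \<open>q\<close> in \<open>S\<^sub>i\<^sub>j\<close>. Each equivalence then follows by multiplying a factorisation of \<open>x\<close>
  over \<open>y\<close> by these further factors: those of \<open>x\<close> are placed on the outside, those of \<open>y\<close> on the
  inside.
\<close>

section \<open>Green's preorders without adjoined identities\<close>

context partial_semigroup
begin

lemma mult_closed [simp]:
  assumes "x \<in> arr S" "y \<in> arr S" "tgt S x = src S y"
  shows "x \<cdot> y \<in> arr S" "src S (x \<cdot> y) = src S x" "tgt S (x \<cdot> y) = tgt S y"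
  using assms mult_in src_mult tgt_mult by (auto simp: composable_def)

lemma mult_assoc [simp]:
  assumes "x \<in> arr S" "y \<in> arr S" "z \<in> arr S" "tgt S x = src S y" "tgt S y = src S z"
  shows "(x \<cdot> y) \<cdot> z = x \<cdot> (y \<cdot> z)"
  using assms assoc by (simp add: composable_def)

text \<open>Each object carries an identity in \<open>S\<^sup>(\<^sup>1\<^sup>)\<close>, old or new. The next two lemmas turn a
  multiplication by an element of \<open>S\<^sup>(\<^sup>1\<^sup>)\<close> into a case distinction inside \<open>S\<close>.\<close>

lemma right_factor_adjoin_ids:
  assumes "y \<in> arr S"
  shows "(\<exists>u. composable (adjoin_ids S) (Inl y) u \<and> Inl x = mult (adjoin_ids S) (Inl y) u) \<longleftrightarrow>
    x = y \<or> (\<exists>u. composable S y u \<and> x = y \<cdot> u)"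
proof -
  have "(\<exists>u. composable (adjoin_ids S) (Inl y) u \<and> Inl x = mult (adjoin_ids S) (Inl y) u) \<longleftrightarrow>
    (\<exists>u. composable S y u \<and> x = y \<cdot> u) \<or> x = y \<and> (\<nexists>e. is_identity S (tgt S y) e)"
    using assms tgt_in[OF assms] unfolding split_sum_ex
    by (simp add: composable_def adjoin_ids_def inj_image_mem_iff image_iff conj_commute)
  moreover have "composable S y e \<and> y \<cdot> e = y" if "is_identity S (tgt S y) e" for e
    using assms that by (simp add: is_identity_def hom_def composable_def)
  ultimately show ?thesis by metis
qed

lemma left_factor_adjoin_ids:
  assumes "y \<in> arr S"
  shows "(\<exists>u. composable (adjoin_ids S) u (Inl y) \<and> Inl x = mult (adjoin_ids S) u (Inl y)) \<longleftrightarrow>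
    x = y \<or> (\<exists>u. composable S u y \<and> x = u \<cdot> y)"
proof -
  have "(\<exists>u. composable (adjoin_ids S) u (Inl y) \<and> Inl x = mult (adjoin_ids S) u (Inl y)) \<longleftrightarrow>
    (\<exists>u. composable S u y \<and> x = u \<cdot> y) \<or> x = y \<and> (\<nexists>e. is_identity S (src S y) e)"
    using assms src_in[OF assms] unfolding split_sum_ex
    by (simp add: composable_def adjoin_ids_def inj_image_mem_iff image_iff conj_commute)
  moreover have "composable S e y \<and> e \<cdot> y = y" if "is_identity S (src S y) e" for e
    using assms that by (simp add: is_identity_def hom_def composable_def)
  ultimately show ?thesis by metis
qed

lemma leR_iff:
  "leR S x y \<longleftrightarrow> x \<in> arr S \<and> y \<in> arr S \<and> (x = y \<or> (\<exists>u. composable S y u \<and> x = y \<cdot> u))"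
  unfolding leR_def using right_factor_adjoin_ids by blast

lemma leL_iff:
  "leL S x y \<longleftrightarrow> x \<in> arr S \<and> y \<in> arr S \<and> (x = y \<or> (\<exists>u. composable S u y \<and> x = u \<cdot> y))"
  unfolding leL_def using left_factor_adjoin_ids by blast

text \<open>The \<open>J\<close>-preorder is the composite of the \<open>R\<close>- and \<open>L\<close>-preorders.\<close>

lemma leJ_iff_leR_leL: "leJ S x y \<longleftrightarrow> (\<exists>w. leR S x w \<and> leL S w y)"
proof
  assume "leJ S x y"
  then obtain u v where arrs: "x \<in> arr S" "y \<in> arr S"
    and u: "composable (adjoin_ids S) u (Inl y)" and v: "composable (adjoin_ids S) (Inl y) v"
    and x: "Inl x = mult (adjoin_ids S) (mult (adjoin_ids S) u (Inl y)) v"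
    by (auto simp: leJ_def)
  obtain w where w: "mult (adjoin_ids S) u (Inl y) = Inl w" "w \<in> arr S" "tgt S w = tgt S y"
    using u arrs by (cases u) (auto simp: adjoin_ids_def composable_def)
  have "leL S w y"
    unfolding leL_def using arrs u w by metis
  moreover have "composable (adjoin_ids S) (Inl w) v"
    using v w by (simp add: composable_def adjoin_ids_def)
  then have "leR S x w"
    unfolding leR_def using arrs w x by auto
  ultimately show "\<exists>w. leR S x w \<and> leL S w y" by blast
next
  assume "\<exists>w. leR S x w \<and> leL S w y"
  then obtain w u v where arrs: "x \<in> arr S" "w \<in> arr S" "y \<in> arr S"
    and v: "composable (adjoin_ids S) (Inl w) v" "Inl x = mult (adjoin_ids S) (Inl w) v"
    and u: "composable (adjoin_ids S) u (Inl y)" "Inl w = mult (adjoin_ids S) u (Inl y)"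
    by (auto simp: leR_def leL_def)
  have "tgt S w = tgt S y"
    using u arrs by (cases u) (auto simp: adjoin_ids_def composable_def)
  then have "composable (adjoin_ids S) (Inl y) v"
    using v(1) arrs by (simp add: composable_def adjoin_ids_def)
  then show "leJ S x y"
    unfolding leJ_def using arrs u v by auto
qed

lemma leJ_iff:
  "leJ S x y \<longleftrightarrow> x \<in> arr S \<and> y \<in> arr S \<and>
     (x = y \<or> (\<exists>u. composable S u y \<and> x = u \<cdot> y) \<or> (\<exists>v. composable S y v \<and> x = y \<cdot> v) \<or>
      (\<exists>u v. composable S u y \<and> composable S y v \<and> x = u \<cdot> (y \<cdot> v)))"
  (is "_ \<longleftrightarrow> ?rhs")
proof
  assume "leJ S x y"
  then obtain w where arrs: "x \<in> arr S" "y \<in> arr S"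
    and x: "x = w \<or> (\<exists>v. composable S w v \<and> x = w \<cdot> v)"
    and w: "w = y \<or> (\<exists>u. composable S u y \<and> w = u \<cdot> y)"
    unfolding leJ_iff_leR_leL leR_iff leL_iff by blast
  have "composable S y v \<and> (u \<cdot> y) \<cdot> v = u \<cdot> (y \<cdot> v)"
    if "composable S u y" "composable S (u \<cdot> y) v" for u v
    using that by (simp add: composable_def)
  with arrs x w show ?rhs by metis
next
  assume ?rhs
  then consider "x = y" "x \<in> arr S"
    | u where "composable S u y" "x = u \<cdot> y"
    | v where "composable S y v" "x = y \<cdot> v"
    | u v where "composable S u y" "composable S y v" "x = u \<cdot> (y \<cdot> v)"
    by blast
  then show "leJ S x y"
  proof cases
    case 1
    then show ?thesis by (auto simp: leJ_iff_leR_leL leR_iff leL_iff)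
  next
    case 2
    then have "leR S x x" "leL S x y" by (auto simp: leR_iff leL_iff composable_def)
    then show ?thesis unfolding leJ_iff_leR_leL by blast
  next
    case 3
    then have "leR S x y" "leL S y y" by (auto simp: leR_iff leL_iff composable_def)
    then show ?thesis unfolding leJ_iff_leR_leL by blast
  next
    case 4
    then have "x = (u \<cdot> y) \<cdot> v" by (simp add: composable_def)
    with 4 have "leR S x (u \<cdot> y)" "leL S (u \<cdot> y) y"
      by (auto simp: leR_iff leL_iff composable_def simp del: mult_assoc)
    then show ?thesis unfolding leJ_iff_leR_leL by blast
  qed
qed

end

section \<open>Factorisations through the sandwich element\<close>

text \<open>A sandwich element \<open>a\<close> of \<open>S\<^sub>j\<^sub>i\<close>, together with a left identity \<open>e\<close> and a right identity
  \<open>f\<close> for it. Below, \<open>e\<close> and \<open>f\<close> are shown to lie in \<open>S\<^sub>j\<^sub>j\<close> and \<open>S\<^sub>i\<^sub>i\<close>; they need not be identities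
  for any other element. The simplifier associates all products to the right.\<close>

locale sandwich_element = partial_semigroup +
  fixes i j and a e f
  assumes a_hom: "a \<in> hom S j i"
    and e_comp: "composable S e a" and e_id: "e \<cdot> a = a"
    and f_comp: "composable S a f" and f_id: "a \<cdot> f = a"
begin

lemma type_simps [simp]:
  "a \<in> arr S" "src S a = j" "tgt S a = i"
  "e \<in> arr S" "src S e = j" "tgt S e = j"
  "f \<in> arr S" "src S f = i" "tgt S f = i"
proof -
  show a: "a \<in> arr S" "src S a = j" "tgt S a = i"
    using a_hom by (auto simp: hom_def)
  show e: "e \<in> arr S" "tgt S e = j" and f: "f \<in> arr S" "src S f = i"
    using e_comp f_comp a by (auto simp: composable_def)
  show "src S e = j" "tgt S f = i"
    using src_mult[OF e_comp] tgt_mult[OF f_comp] a by (simp_all add: e_id f_id)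
qed

lemma local_identities [simp]:
  "e \<cdot> a = a" "z \<in> arr S \<Longrightarrow> src S z = i \<Longrightarrow> e \<cdot> (a \<cdot> z) = a \<cdot> z"
  "a \<cdot> f = a" "z \<in> arr S \<Longrightarrow> src S z = i \<Longrightarrow> a \<cdot> (f \<cdot> z) = a \<cdot> z"
  using mult_assoc[of e a z] mult_assoc[of a f z] by (simp_all add: e_id f_id del: mult_assoc)

lemma partial_semigroup_sandwich: "partial_semigroup (sandwich S i j a)"
  by unfold_locales (auto simp: sandwich_def composable_def hom_def)

lemma leJ_sandwich_iff:
  assumes "x \<in> hom S i j" "y \<in> hom S i j"
  shows "leJ (sandwich S i j a) x y \<longleftrightarrow>
    x = y \<or> (\<exists>u \<in> hom S i j. x = u \<cdot> (a \<cdot> y)) \<or> (\<exists>v \<in> hom S i j. x = y \<cdot> (a \<cdot> v)) \<or>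
    (\<exists>u \<in> hom S i j. \<exists>v \<in> hom S i j. x = u \<cdot> (a \<cdot> (y \<cdot> (a \<cdot> v))))"
proof -
  interpret T: partial_semigroup "sandwich S i j a"
    by (rule partial_semigroup_sandwich)
  have "leJ (sandwich S i j a) x y \<longleftrightarrow>
    x = y \<or> (\<exists>u \<in> hom S i j. x = u \<cdot> a \<cdot> y) \<or> (\<exists>v \<in> hom S i j. x = y \<cdot> a \<cdot> v) \<or>
    (\<exists>u \<in> hom S i j. \<exists>v \<in> hom S i j. x = u \<cdot> a \<cdot> (y \<cdot> a \<cdot> v))"
    using assms unfolding T.leJ_iff by (auto simp: sandwich_def composable_def)
  also have "\<dots> \<longleftrightarrow>
    x = y \<or> (\<exists>u \<in> hom S i j. x = u \<cdot> (a \<cdot> y)) \<or> (\<exists>v \<in> hom S i j. x = y \<cdot> (a \<cdot> v)) \<or>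
    (\<exists>u \<in> hom S i j. \<exists>v \<in> hom S i j. x = u \<cdot> (a \<cdot> (y \<cdot> (a \<cdot> v))))"
    using assms by (simp add: hom_def cong: conj_cong)
  finally show ?thesis .
qed

lemma leR_mult_a_iff:
  assumes "x \<in> hom S i j" "y \<in> hom S i j"
  shows "leR S x (y \<cdot> a) \<longleftrightarrow> (\<exists>v \<in> hom S i j. x = y \<cdot> (a \<cdot> v))"
proof
  assume "leR S x (y \<cdot> a)"
  then consider "x = y \<cdot> a" | u where "composable S (y \<cdot> a) u" "x = y \<cdot> a \<cdot> u"
    by (auto simp: leR_iff)
  then show "\<exists>v \<in> hom S i j. x = y \<cdot> (a \<cdot> v)"
  proof cases
    case 1
    \<comment> \<open>Comparing targets gives \<open>i = j\<close>, so that \<open>f\<close> lies in \<open>S\<^sub>i\<^sub>j\<close>.\<close>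
    then have "f \<in> hom S i j" "x = y \<cdot> (a \<cdot> f)"
      using assms by (auto simp: hom_def)
    then show ?thesis by blast
  next
    case 2
    then have "f \<cdot> u \<in> hom S i j" "x = y \<cdot> (a \<cdot> (f \<cdot> u))"
      using assms by (auto simp: hom_def composable_def)
    then show ?thesis by blast
  qed
next
  assume "\<exists>v \<in> hom S i j. x = y \<cdot> (a \<cdot> v)"
  then obtain v where "v \<in> hom S i j" "x = y \<cdot> (a \<cdot> v)" ..
  then have "composable S (y \<cdot> a) v" "x = y \<cdot> a \<cdot> v"
    using assms by (auto simp: hom_def composable_def)
  then show "leR S x (y \<cdot> a)"
    using assms by (auto simp: leR_iff composable_def hom_def)
qed

lemma leL_a_mult_iff:
  assumes "x \<in> hom S i j" "y \<in> hom S i j"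
  shows "leL S x (a \<cdot> y) \<longleftrightarrow> (\<exists>u \<in> hom S i j. x = u \<cdot> (a \<cdot> y))"
proof
  assume "leL S x (a \<cdot> y)"
  then consider "x = a \<cdot> y" | u where "composable S u (a \<cdot> y)" "x = u \<cdot> (a \<cdot> y)"
    by (auto simp: leL_iff)
  then show "\<exists>u \<in> hom S i j. x = u \<cdot> (a \<cdot> y)"
  proof cases
    case 1
    \<comment> \<open>Comparing sources gives \<open>i = j\<close>, so that \<open>e\<close> lies in \<open>S\<^sub>i\<^sub>j\<close>.\<close>
    then have "e \<in> hom S i j" "x = e \<cdot> (a \<cdot> y)"
      using assms by (auto simp: hom_def)
    then show ?thesis by blast
  next
    case 2
    then have "u \<in> hom S i j"
      using assms by (auto simp: hom_def composable_def)
    with 2 show ?thesis by blast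
  qed
next
  assume "\<exists>u \<in> hom S i j. x = u \<cdot> (a \<cdot> y)"
  then show "leL S x (a \<cdot> y)"
    using assms by (auto simp: leL_iff composable_def hom_def)
qed

lemma leJ_a_mult_a_iff:
  assumes "x \<in> hom S i j" "y \<in> hom S i j"
  shows "leJ S x (a \<cdot> y \<cdot> a) \<longleftrightarrow>
    (\<exists>u \<in> hom S i j. \<exists>v \<in> hom S i j. x = u \<cdot> (a \<cdot> (y \<cdot> (a \<cdot> v))))"
proof
  note [simp] = composable_def
  have y: "y \<in> arr S" "src S y = i" "tgt S y = j" and x: "src S x = i" "tgt S x = j"
    using assms by (auto simp: hom_def)
  assume "leJ S x (a \<cdot> y \<cdot> a)"
  then consider "x = a \<cdot> (y \<cdot> a)"
    | u where "composable S u a" "x = u \<cdot> (a \<cdot> (y \<cdot> a))"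
    | v where "composable S a v" "x = a \<cdot> (y \<cdot> (a \<cdot> v))"
    | u v where "composable S u a" "composable S a v" "x = u \<cdot> (a \<cdot> (y \<cdot> (a \<cdot> v)))"
    unfolding leJ_iff using y by auto
  \<comment> \<open>An absent outer factor is replaced by \<open>e\<close> on the left and by \<open>f\<close> on the right.\<close>
  then obtain u v where "u \<in> hom S i j" "v \<in> hom S i j" "x = u \<cdot> (a \<cdot> (y \<cdot> (a \<cdot> v)))"
  proof cases
    case 1
    with x y show ?thesis by (intro that[of e f]) (auto simp: hom_def)
  next
    case 2
    with x y show ?thesis by (intro that[of u f]) (auto simp: hom_def)
  next
    case 3
    with x y show ?thesis by (intro that[of e v]) (auto simp: hom_def)
  next
    case 4
    with x y show ?thesis by (intro that[of u v]) (auto simp: hom_def)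
  qed
  then show "\<exists>u \<in> hom S i j. \<exists>v \<in> hom S i j. x = u \<cdot> (a \<cdot> (y \<cdot> (a \<cdot> v)))" by blast
next
  assume "\<exists>u \<in> hom S i j. \<exists>v \<in> hom S i j. x = u \<cdot> (a \<cdot> (y \<cdot> (a \<cdot> v)))"
  then obtain u v where uv: "u \<in> hom S i j" "v \<in> hom S i j" "x = u \<cdot> (a \<cdot> (y \<cdot> (a \<cdot> v)))"
    by blast
  then have "composable S u (a \<cdot> y \<cdot> a)" "composable S (a \<cdot> y \<cdot> a) v"
    "x = u \<cdot> ((a \<cdot> y \<cdot> a) \<cdot> v)" "a \<cdot> y \<cdot> a \<in> arr S" "x \<in> arr S"
    using assms by (auto simp: composable_def hom_def)
  then show "leJ S x (a \<cdot> y \<cdot> a)"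
    unfolding leJ_iff by blast
qed

section \<open>Elements of \<open>P1\<close>, \<open>P2\<close> and \<open>P3\<close>\<close>

text \<open>The second equation in each of the following three lemmas is the first one multiplied by
  \<open>z\<close>, with all products associated to the right.\<close>

lemma P1_factor:
  assumes "x \<in> P1 S i j a"
  obtains w where "w \<in> hom S i j" "x \<cdot> (a \<cdot> w) = x"
    "\<And>z. z \<in> arr S \<Longrightarrow> src S z = j \<Longrightarrow> x \<cdot> (a \<cdot> (w \<cdot> z)) = x \<cdot> z"
proof -
  have x: "x \<in> hom S i j" and "leR S x (x \<cdot> a)"
    using assms by (auto simp: P1_def relR_def)
  then obtain w where w: "w \<in> hom S i j" "x \<cdot> (a \<cdot> w) = x"
    unfolding leR_mult_a_iff[OF x x] by metis
  have "x \<cdot> (a \<cdot> (w \<cdot> z)) = x \<cdot> z" if "z \<in> arr S" "src S z = j" for z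
  proof -
    have "x \<cdot> (a \<cdot> (w \<cdot> z)) = (x \<cdot> (a \<cdot> w)) \<cdot> z"
      using x w(1) that by (simp add: hom_def)
    then show ?thesis by (simp only: w(2))
  qed
  with w that show thesis by blast
qed

lemma P2_factor:
  assumes "x \<in> P2 S i j a"
  obtains w where "w \<in> hom S i j" "w \<cdot> (a \<cdot> x) = x"
    "\<And>z. z \<in> arr S \<Longrightarrow> src S z = j \<Longrightarrow> w \<cdot> (a \<cdot> (x \<cdot> z)) = x \<cdot> z"
proof -
  have x: "x \<in> hom S i j" and "leL S x (a \<cdot> x)"
    using assms by (auto simp: P2_def relL_def)
  then obtain w where w: "w \<in> hom S i j" "w \<cdot> (a \<cdot> x) = x"
    unfolding leL_a_mult_iff[OF x x] by metis
  have "w \<cdot> (a \<cdot> (x \<cdot> z)) = x \<cdot> z" if "z \<in> arr S" "src S z = j" for z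
  proof -
    have "w \<cdot> (a \<cdot> (x \<cdot> z)) = (w \<cdot> (a \<cdot> x)) \<cdot> z"
      using x w(1) that by (simp add: hom_def)
    then show ?thesis by (simp only: w(2))
  qed
  with w that show thesis by blast
qed

lemma P3_factor:
  assumes "x \<in> P3 S i j a"
  obtains p q where "p \<in> hom S i j" "q \<in> hom S i j" "p \<cdot> (a \<cdot> (x \<cdot> (a \<cdot> q))) = x"
    "\<And>z. z \<in> arr S \<Longrightarrow> src S z = j \<Longrightarrow> p \<cdot> (a \<cdot> (x \<cdot> (a \<cdot> (q \<cdot> z)))) = x \<cdot> z"
proof -
  have x: "x \<in> hom S i j" and "leJ S x (a \<cdot> x \<cdot> a)"
    using assms by (auto simp: P3_def relJ_def)
  then obtain p q where pq: "p \<in> hom S i j" "q \<in> hom S i j" "p \<cdot> (a \<cdot> (x \<cdot> (a \<cdot> q))) = x"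
    unfolding leJ_a_mult_a_iff[OF x x] by metis
  have "p \<cdot> (a \<cdot> (x \<cdot> (a \<cdot> (q \<cdot> z)))) = x \<cdot> z" if "z \<in> arr S" "src S z = j" for z
  proof -
    have "p \<cdot> (a \<cdot> (x \<cdot> (a \<cdot> (q \<cdot> z)))) = (p \<cdot> (a \<cdot> (x \<cdot> (a \<cdot> q)))) \<cdot> z"
      using x pq(1,2) that by (simp add: hom_def)
    then show ?thesis by (simp only: pq(3))
  qed
  with pq that show thesis by blast
qed

section \<open>The sandwich \<open>J\<close>-preorder below and above such elements\<close>

lemma leJ_sandwich_iff_left_P1:
  assumes "x \<in> P1 S i j a" "y \<in> hom S i j"
  shows "leJ (sandwich S i j a) x y \<longleftrightarrow> leJ S x (a \<cdot> y \<cdot> a) \<or> leR S x (y \<cdot> a)"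
proof -
  have x: "x \<in> hom S i j" using assms by (simp add: P1_def)
  obtain w where w: "w \<in> hom S i j" "x \<cdot> (a \<cdot> w) = x"
    using P1_factor[OF assms(1)] by blast
  have "\<exists>v \<in> hom S i j. x = y \<cdot> (a \<cdot> v)" if "x = y"
    by (rule bexI[of _ w]) (use w that in simp_all)
  moreover have "\<exists>v \<in> hom S i j. x = u \<cdot> (a \<cdot> (y \<cdot> (a \<cdot> v)))"
    if "u \<in> hom S i j" "x = u \<cdot> (a \<cdot> y)" for u
  proof
    have "u \<cdot> (a \<cdot> y) \<cdot> (a \<cdot> w) = x" using w(2) that(2) by simp
    then show "x = u \<cdot> (a \<cdot> (y \<cdot> (a \<cdot> w)))"
      using that(1) assms(2) w(1) by (simp add: hom_def)
  qed (fact w(1))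
  ultimately show ?thesis
    unfolding leJ_sandwich_iff[OF x assms(2)] leJ_a_mult_a_iff[OF x assms(2)]
      leR_mult_a_iff[OF x assms(2)] by blast
qed

lemma leJ_sandwich_iff_left_P2:
  assumes "x \<in> P2 S i j a" "y \<in> hom S i j"
  shows "leJ (sandwich S i j a) x y \<longleftrightarrow> leJ S x (a \<cdot> y \<cdot> a) \<or> leL S x (a \<cdot> y)"
proof -
  have x: "x \<in> hom S i j" using assms by (simp add: P2_def)
  obtain w where w: "w \<in> hom S i j" "w \<cdot> (a \<cdot> x) = x"
    using P2_factor[OF assms(1)] by blast
  have "\<exists>u \<in> hom S i j. x = u \<cdot> (a \<cdot> y)" if "x = y"
    by (rule bexI[of _ w]) (use w that in simp_all)
  moreover have "\<exists>u \<in> hom S i j. x = u \<cdot> (a \<cdot> (y \<cdot> (a \<cdot> v)))"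
    if "v \<in> hom S i j" "x = y \<cdot> (a \<cdot> v)" for v
    by (rule bexI[of _ w]) (use w that in simp_all)
  ultimately show ?thesis
    unfolding leJ_sandwich_iff[OF x assms(2)] leJ_a_mult_a_iff[OF x assms(2)]
      leL_a_mult_iff[OF x assms(2)] by blast
qed

lemma leJ_sandwich_iff_left_P3:
  assumes "x \<in> P3 S i j a" "y \<in> hom S i j"
  shows "leJ (sandwich S i j a) x y \<longleftrightarrow> leJ S x (a \<cdot> y \<cdot> a)"
proof -
  have x: "x \<in> hom S i j" using assms by (simp add: P3_def)
  obtain p q where pq: "p \<in> hom S i j" "q \<in> hom S i j" "p \<cdot> (a \<cdot> (x \<cdot> (a \<cdot> q))) = x"
    using P3_factor[OF assms(1)] by blast
  \<comment> \<open>The middle factor of \<open>x = p \<cdot> a \<cdot> x \<cdot> a \<cdot> q\<close> is expanded over \<open>y\<close>.\<close>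
  have "\<exists>u \<in> hom S i j. \<exists>v \<in> hom S i j. x = u \<cdot> (a \<cdot> (y \<cdot> (a \<cdot> v)))"
    if le: "leJ (sandwich S i j a) x y"
  proof -
    consider "x = y" | u where "u \<in> hom S i j" "x = u \<cdot> (a \<cdot> y)"
      | v where "v \<in> hom S i j" "x = y \<cdot> (a \<cdot> v)"
      | u v where "u \<in> hom S i j" "v \<in> hom S i j" "x = u \<cdot> (a \<cdot> (y \<cdot> (a \<cdot> v)))"
      using le leJ_sandwich_iff[OF x assms(2)] by blast
    then show ?thesis
    proof cases
      case 1
      with pq show ?thesis by (intro bexI[of _ p] bexI[of _ q]) simp_all
    next
      case 2
      have "x = p \<cdot> (a \<cdot> ((u \<cdot> (a \<cdot> y)) \<cdot> (a \<cdot> q)))" using pq(3) 2(2) by simp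
      also have "\<dots> = (p \<cdot> (a \<cdot> u)) \<cdot> (a \<cdot> (y \<cdot> (a \<cdot> q)))"
        using pq(1,2) 2(1) assms(2) by (simp add: hom_def)
      finally have "x = (p \<cdot> (a \<cdot> u)) \<cdot> (a \<cdot> (y \<cdot> (a \<cdot> q)))" .
      moreover have "p \<cdot> (a \<cdot> u) \<in> hom S i j" using pq(1) 2(1) by (simp add: hom_def)
      ultimately show ?thesis using pq(2) by blast
    next
      case 3
      have "x = p \<cdot> (a \<cdot> ((y \<cdot> (a \<cdot> v)) \<cdot> (a \<cdot> q)))" using pq(3) 3(2) by simp
      also have "\<dots> = p \<cdot> (a \<cdot> (y \<cdot> (a \<cdot> (v \<cdot> (a \<cdot> q)))))"
        using pq(1,2) 3(1) assms(2) by (simp add: hom_def)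
      finally have "x = p \<cdot> (a \<cdot> (y \<cdot> (a \<cdot> (v \<cdot> (a \<cdot> q)))))" .
      moreover have "v \<cdot> (a \<cdot> q) \<in> hom S i j" using pq(2) 3(1) by (simp add: hom_def)
      ultimately show ?thesis using pq(1) by blast
    next
      case 4
      then show ?thesis by blast
    qed
  qed
  then show ?thesis
    unfolding leJ_a_mult_a_iff[OF x assms(2)] leJ_sandwich_iff[OF x assms(2)] by blast
qed

lemma leJ_sandwich_iff_right_P1:
  assumes "x \<in> hom S i j" "y \<in> P1 S i j a"
  shows "leJ (sandwich S i j a) x y \<longleftrightarrow> leJ S x (a \<cdot> y) \<or> leR S x y"
proof -
  have y: "y \<in> hom S i j" using assms by (simp add: P1_def)
  obtain w where w: "w \<in> hom S i j" "y \<cdot> (a \<cdot> w) = y"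
    "\<And>z. z \<in> arr S \<Longrightarrow> src S z = j \<Longrightarrow> y \<cdot> (a \<cdot> (w \<cdot> z)) = y \<cdot> z"
    using P1_factor[OF assms(2)] by blast
  have types [simp]: "x \<in> arr S" "src S x = i" "tgt S x = j" "y \<in> arr S" "src S y = i" "tgt S y = j"
    "w \<in> arr S" "src S w = i" "tgt S w = j"
    using assms y w(1) by (auto simp: hom_def)
  show ?thesis
  proof
    assume "leJ (sandwich S i j a) x y"
    then consider "x = y" | u where "u \<in> hom S i j" "x = u \<cdot> (a \<cdot> y)"
      | v where "v \<in> hom S i j" "x = y \<cdot> (a \<cdot> v)"
      | u v where "u \<in> hom S i j" "v \<in> hom S i j" "x = u \<cdot> ((a \<cdot> y) \<cdot> (a \<cdot> v))"
      using leJ_sandwich_iff[OF assms(1) y] by (auto simp: hom_def)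
    then show "leJ S x (a \<cdot> y) \<or> leR S x y"
    proof cases
      case 1
      then show ?thesis by (simp add: leR_iff)
    next
      case 2
      then have "composable S u (a \<cdot> y)" by (simp add: composable_def hom_def)
      with 2 show ?thesis unfolding leJ_iff using types by auto
    next
      case 3
      then have "composable S y (a \<cdot> v)" by (simp add: composable_def hom_def)
      with 3 show ?thesis unfolding leR_iff using types by auto
    next
      case 4
      then have "composable S u (a \<cdot> y)" "composable S (a \<cdot> y) (a \<cdot> v)"
        by (simp_all add: composable_def hom_def)
      with 4 show ?thesis unfolding leJ_iff using types by (auto simp del: mult_assoc)
    qed
  next
    assume "leJ S x (a \<cdot> y) \<or> leR S x y"
    then consider "x = a \<cdot> y"
      | u where "composable S u a" "x = u \<cdot> (a \<cdot> y)"
      | v where "composable S y v" "x = a \<cdot> (y \<cdot> v)"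
      | u v where "composable S u a" "composable S y v" "x = u \<cdot> (a \<cdot> (y \<cdot> v))"
      | "x = y" | v where "composable S y v" "x = y \<cdot> v"
      unfolding leJ_iff leR_iff by (auto simp: composable_def)
    \<comment> \<open>A factor \<open>v\<close> to the right of \<open>y\<close> becomes \<open>a \<cdot> w \<cdot> v\<close>, since \<open>y = y \<cdot> a \<cdot> w\<close>; a factor
      missing to the left of \<open>a\<close> is supplied by \<open>e\<close>.\<close>
    then show "leJ (sandwich S i j a) x y"
    proof cases
      case 1
      then have "e \<in> hom S i j" "x = e \<cdot> (a \<cdot> y)"
        using types(2) by (auto simp: hom_def)
      then show ?thesis unfolding leJ_sandwich_iff[OF assms(1) y] by blast
    next
      case 2
      then have "u \<in> hom S i j"
        using types(2) by (auto simp: hom_def composable_def)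
      with 2 show ?thesis unfolding leJ_sandwich_iff[OF assms(1) y] by blast
    next
      case 3
      then have "e \<in> hom S i j" "w \<cdot> v \<in> hom S i j" "x = e \<cdot> (a \<cdot> (y \<cdot> (a \<cdot> (w \<cdot> v))))"
        using types(2,3) by (auto simp: hom_def composable_def w(3))
      then show ?thesis unfolding leJ_sandwich_iff[OF assms(1) y] by blast
    next
      case 4
      then have "u \<in> hom S i j" "w \<cdot> v \<in> hom S i j" "x = u \<cdot> (a \<cdot> (y \<cdot> (a \<cdot> (w \<cdot> v))))"
        using types(2,3) by (auto simp: hom_def composable_def w(3))
      then show ?thesis unfolding leJ_sandwich_iff[OF assms(1) y] by blast
    next
      case 5
      then show ?thesis unfolding leJ_sandwich_iff[OF assms(1) y] by blast
    next
      case 6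
      then have "w \<cdot> v \<in> hom S i j" "x = y \<cdot> (a \<cdot> (w \<cdot> v))"
        using types(3) by (auto simp: hom_def composable_def w(3))
      then show ?thesis unfolding leJ_sandwich_iff[OF assms(1) y] by blast
    qed
  qed
qed

lemma leJ_sandwich_iff_right_P2:
  assumes "x \<in> hom S i j" "y \<in> P2 S i j a"
  shows "leJ (sandwich S i j a) x y \<longleftrightarrow> leJ S x (y \<cdot> a) \<or> leL S x y"
proof -
  have y: "y \<in> hom S i j" using assms by (simp add: P2_def)
  obtain w where w: "w \<in> hom S i j" "w \<cdot> (a \<cdot> y) = y"
    "\<And>z. z \<in> arr S \<Longrightarrow> src S z = j \<Longrightarrow> w \<cdot> (a \<cdot> (y \<cdot> z)) = y \<cdot> z"
    using P2_factor[OF assms(2)] by blast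
  have types [simp]: "x \<in> arr S" "src S x = i" "tgt S x = j" "y \<in> arr S" "src S y = i" "tgt S y = j"
    "w \<in> arr S" "src S w = i" "tgt S w = j"
    using assms y w(1) by (auto simp: hom_def)
  show ?thesis
  proof
    assume "leJ (sandwich S i j a) x y"
    then consider "x = y" | u where "u \<in> hom S i j" "x = (u \<cdot> a) \<cdot> y"
      | v where "v \<in> hom S i j" "x = (y \<cdot> a) \<cdot> v"
      | u v where "u \<in> hom S i j" "v \<in> hom S i j" "x = (u \<cdot> a) \<cdot> ((y \<cdot> a) \<cdot> v)"
      using leJ_sandwich_iff[OF assms(1) y] by (auto simp: hom_def)
    then show "leJ S x (y \<cdot> a) \<or> leL S x y"
    proof cases
      case 1
      then show ?thesis by (simp add: leL_iff)
    next
      case 2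
      then have "composable S (u \<cdot> a) y" by (simp add: composable_def hom_def)
      with 2 show ?thesis unfolding leL_iff using types by blast
    next
      case 3
      then have "composable S (y \<cdot> a) v" "y \<cdot> a \<in> arr S" by (simp_all add: composable_def hom_def)
      with 3 show ?thesis unfolding leJ_iff using types by blast
    next
      case 4
      then have "composable S (u \<cdot> a) (y \<cdot> a)" "composable S (y \<cdot> a) v" "y \<cdot> a \<in> arr S"
        by (simp_all add: composable_def hom_def)
      with 4 show ?thesis unfolding leJ_iff using types by blast
    qed
  next
    assume "leJ S x (y \<cdot> a) \<or> leL S x y"
    then consider "x = y \<cdot> a"
      | u where "composable S u y" "x = u \<cdot> (y \<cdot> a)"
      | v where "composable S a v" "x = y \<cdot> (a \<cdot> v)"
      | u v where "composable S u y" "composable S a v" "x = u \<cdot> (y \<cdot> (a \<cdot> v))"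
      | "x = y" | u where "composable S u y" "x = u \<cdot> y"
      unfolding leJ_iff leL_iff by (auto simp: composable_def)
    \<comment> \<open>A factor \<open>u\<close> to the left of \<open>y\<close> becomes \<open>u \<cdot> w \<cdot> a\<close>, since \<open>y = w \<cdot> a \<cdot> y\<close>; a factor
      missing to the right of \<open>a\<close> is supplied by \<open>f\<close>.\<close>
    then show "leJ (sandwich S i j a) x y"
    proof cases
      case 1
      then have "f \<in> hom S i j" "x = y \<cdot> (a \<cdot> f)"
        using types(3) by (auto simp: hom_def)
      then show ?thesis unfolding leJ_sandwich_iff[OF assms(1) y] by blast
    next
      case 2
      then have "f \<in> hom S i j" "u \<cdot> w \<in> hom S i j" "x = (u \<cdot> w) \<cdot> (a \<cdot> (y \<cdot> (a \<cdot> f)))"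
        using types(2,3) by (auto simp: hom_def composable_def w(3))
      then show ?thesis unfolding leJ_sandwich_iff[OF assms(1) y] by blast
    next
      case 3
      then have "v \<in> hom S i j"
        using types(3) by (auto simp: hom_def composable_def)
      with 3 show ?thesis unfolding leJ_sandwich_iff[OF assms(1) y] by blast
    next
      case 4
      then have "v \<in> hom S i j" "u \<cdot> w \<in> hom S i j" "x = (u \<cdot> w) \<cdot> (a \<cdot> (y \<cdot> (a \<cdot> v)))"
        using types(2,3) by (auto simp: hom_def composable_def w(3))
      then show ?thesis unfolding leJ_sandwich_iff[OF assms(1) y] by blast
    next
      case 5
      then show ?thesis unfolding leJ_sandwich_iff[OF assms(1) y] by blast
    next
      case 6
      then have "u \<cdot> w \<in> hom S i j" "x = (u \<cdot> w) \<cdot> (a \<cdot> y)"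
        using types(2) by (auto simp: hom_def composable_def w(2))
      then show ?thesis unfolding leJ_sandwich_iff[OF assms(1) y] by blast
    qed
  qed
qed

lemma leJ_sandwich_iff_right_P3:
  assumes "x \<in> hom S i j" "y \<in> P3 S i j a"
  shows "leJ (sandwich S i j a) x y \<longleftrightarrow> leJ S x y"
proof -
  have y: "y \<in> hom S i j" using assms by (simp add: P3_def)
  obtain p q where pq: "p \<in> hom S i j" "q \<in> hom S i j" "p \<cdot> (a \<cdot> (y \<cdot> (a \<cdot> q))) = y"
    "\<And>z. z \<in> arr S \<Longrightarrow> src S z = j \<Longrightarrow> p \<cdot> (a \<cdot> (y \<cdot> (a \<cdot> (q \<cdot> z)))) = y \<cdot> z"
    using P3_factor[OF assms(2)] by blast
  have types [simp]: "x \<in> arr S" "src S x = i" "tgt S x = j" "y \<in> arr S" "src S y = i" "tgt S y = j"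
    "p \<in> arr S" "src S p = i" "tgt S p = j" "q \<in> arr S" "src S q = i" "tgt S q = j"
    using assms y pq(1,2) by (auto simp: hom_def)
  show ?thesis
  proof
    assume "leJ (sandwich S i j a) x y"
    then consider "x = y" | u where "u \<in> hom S i j" "x = (u \<cdot> a) \<cdot> y"
      | v where "v \<in> hom S i j" "x = y \<cdot> (a \<cdot> v)"
      | u v where "u \<in> hom S i j" "v \<in> hom S i j" "x = (u \<cdot> a) \<cdot> (y \<cdot> (a \<cdot> v))"
      using leJ_sandwich_iff[OF assms(1) y] by (auto simp: hom_def)
    then show "leJ S x y"
    proof cases
      case 1
      then show ?thesis by (simp add: leJ_iff)
    next
      case 2
      then have "composable S (u \<cdot> a) y" by (simp add: composable_def hom_def)
      with 2 show ?thesis unfolding leJ_iff using types by blast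
    next
      case 3
      then have "composable S y (a \<cdot> v)" by (simp add: composable_def hom_def)
      with 3 show ?thesis unfolding leJ_iff using types by blast
    next
      case 4
      then have "composable S (u \<cdot> a) y" "composable S y (a \<cdot> v)"
        by (simp_all add: composable_def hom_def)
      with 4 show ?thesis unfolding leJ_iff using types by blast
    qed
  next
    assume "leJ S x y"
    then consider "x = y"
      | u where "composable S u y" "x = u \<cdot> y"
      | v where "composable S y v" "x = y \<cdot> v"
      | u v where "composable S u y" "composable S y v" "x = u \<cdot> (y \<cdot> v)"
      unfolding leJ_iff by blast
    \<comment> \<open>Substituting \<open>y = p \<cdot> a \<cdot> y \<cdot> a \<cdot> q\<close> puts \<open>a\<close> on both sides of \<open>y\<close>; then \<open>p\<close> and \<open>q\<close>
      absorb the outer factors.\<close>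
    then show "leJ (sandwich S i j a) x y"
    proof cases
      case 1
      then show ?thesis unfolding leJ_sandwich_iff[OF assms(1) y] by blast
    next
      case 2
      then have "u \<cdot> p \<in> hom S i j" "x = (u \<cdot> p) \<cdot> (a \<cdot> (y \<cdot> (a \<cdot> q)))"
        using types(2) by (auto simp: hom_def composable_def pq(3))
      with pq(2) show ?thesis unfolding leJ_sandwich_iff[OF assms(1) y] by blast
    next
      case 3
      then have "q \<cdot> v \<in> hom S i j" "x = p \<cdot> (a \<cdot> (y \<cdot> (a \<cdot> (q \<cdot> v))))"
        using types(3) by (auto simp: hom_def composable_def pq(4))
      with pq(1) show ?thesis unfolding leJ_sandwich_iff[OF assms(1) y] by blast
    next
      case 4
      then have "u \<cdot> p \<in> hom S i j" "q \<cdot> v \<in> hom S i j"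
        "x = (u \<cdot> p) \<cdot> (a \<cdot> (y \<cdot> (a \<cdot> (q \<cdot> v))))"
        using types(2,3) by (auto simp: hom_def composable_def pq(4))
      then show ?thesis unfolding leJ_sandwich_iff[OF assms(1) y] by blast
    qed
  qed
qed

end

theorem proposition3p7:
  fixes S :: "('a, 'i, 'm) psg_scheme" (structure)
    and i j :: 'i and a x y :: 'a
  assumes "partial_semigroup S"
    and "i \<in> obj S" and "j \<in> obj S"
    and "a \<in> hom S j i"
    and "\<exists>e. composable S e a \<and> a = e \<cdot> a"
    and "\<exists>f. composable S a f \<and> a = a \<cdot> f"
    and "x \<in> hom S i j" and "y \<in> hom S i j"
  shows
    "(x \<in> P1 S i j a \<longrightarrow>
        (leJ (sandwich S i j a) x y \<longleftrightarrow> leJ S x (a \<cdot> y \<cdot> a) \<or> leR S x (y \<cdot> a))) \<and>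
     (x \<in> P2 S i j a \<longrightarrow>
        (leJ (sandwich S i j a) x y \<longleftrightarrow> leJ S x (a \<cdot> y \<cdot> a) \<or> leL S x (a \<cdot> y))) \<and>
     (x \<in> P3 S i j a \<longrightarrow>
        (leJ (sandwich S i j a) x y \<longleftrightarrow> leJ S x (a \<cdot> y \<cdot> a))) \<and>
     (y \<in> P1 S i j a \<longrightarrow>
        (leJ (sandwich S i j a) x y \<longleftrightarrow> leJ S x (a \<cdot> y) \<or> leR S x y)) \<and>
     (y \<in> P2 S i j a \<longrightarrow>
        (leJ (sandwich S i j a) x y \<longleftrightarrow> leJ S x (y \<cdot> a) \<or> leL S x y)) \<and>
     (y \<in> P3 S i j a \<longrightarrow>
        (leJ (sandwich S i j a) x y \<longleftrightarrow> leJ S x y))"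
proof -
  obtain e f where e: "composable S e a" "a = e \<cdot> a" and f: "composable S a f" "a = a \<cdot> f"
    using assms(5,6) by blast
  interpret partial_semigroup S by fact
  interpret sandwich_element S i j a e f
    using assms(4) e f by unfold_locales simp_all
  show ?thesis
    using leJ_sandwich_iff_left_P1[OF _ assms(8)] leJ_sandwich_iff_left_P2[OF _ assms(8)]
      leJ_sandwich_iff_left_P3[OF _ assms(8)] leJ_sandwich_iff_right_P1[OF assms(7)]
      leJ_sandwich_iff_right_P2[OF assms(7)] leJ_sandwich_iff_right_P3[OF assms(7)]
    by simp
qed

end
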